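(* Let $\gamma,\eta,\omega,\lambda\in\mathbb{R}$, $a\in\mathbb{C}$, $k\in\mathbb{Z}$, $m\in\mathbb{N}$ and $n\in\mathbb{N}_0$. Then $${}_{\mathfrak{B}}\mathfrak{D}_{n,a}^{[k,m-1]}(\gamma,\eta;\lambda)=\sum_{j=0}^{n}\binom{n}{j}\,\mathfrak{D}_{n-j,a}^{[k,m-1]}(\gamma;\eta-\omega)\,\mathfrak{B}_{j,a}^{[m-1]}(\omega;\lambda),$$ where ${}_{\mathfrak{B}}\mathfrak{D}_{n,a}^{[k,m-1]}(\gamma,\eta;\lambda)$ are the generalized Apostol-Bernoulli poly-Daehee polynomials, $\mathfrak{B}_{j,a}^{[m-1]}(\omega;\lambda)$ the generalized Apostol-Bernoulli polynomials, and $\mathfrak{D}_{n,a}^{[k,m-1]}(\gamma;\theta)$ (without left subscript) denotes the coefficients in $$(1+x)^{\gamma}\,\frac{\log(1+x)}{\mathrm{Li}_k(1-e^{-x})}\,e^{\theta x}=\sum_{n=0}^\infty\mathfrak{D}_{n,a}^{[k,m-1]}(\gamma;\theta)\frac{x^n}{n!}$$ (which in fact do not depend on $a$ or $m$).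
   Context: $\mathbb{N}=\{1,2,\dots\}$, $\mathbb{N}_0=\mathbb{N}\cup\{0\}$. The polylogarithm is $\mathrm{Li}_k(z)=\sum_{r=1}^{\infty} z^r/r^k$. Generalized Apostol-Bernoulli poly-Daehee polynomials (GABPDP), defined by the generating function $$(1+x)^{\gamma}\,\frac{\log(1+x)}{\mathrm{Li}_k(1-e^{-x})}\,e^{\eta x}\left(\frac{x^m}{\lambda e^x-\sum_{l=0}^{m-1}\frac{x^l}{l!}}\right)^{a}=\sum_{n=0}^\infty {}_{\mathfrak{B}}\mathfrak{D}_{n,a}^{[k,m-1]}(\gamma,\eta;\lambda)\frac{x^n}{n!}.$$ Generalized Apostol-Bernoulli polynomials of order $a\in\mathbb{C}$: $$e^{\eta x}\left(\frac{x^m}{\lambda e^x-\sum_{l=0}^{m-1}\frac{x^l}{l!}}\right)^{a}=\sum_{n=0}^\infty\mathfrak{B}_{n,a}^{[m-1]}(\eta;\lambda)\frac{x^n}{n!}.$$ *)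

theory Defs
  imports "HOL-Analysis.Analysis"
begin

text \<open>
  All generating functions are formal power series over the complex numbers; the \<open>n\<close>-th
  member of the family generated by \<open>F\<close> is \<open>fact n * fps_nth F n\<close>.
\<close>

text \<open>
  Complex powers. Write \<open>f = x\<^sup>d u\<close> with \<open>d = subdegree f\<close> and \<open>c = u(0) \<noteq> 0\<close>. Then
  \<open>f\<^sup>a = x\<^sup>d\<^sup>a c\<^sup>a (1 + (u/c - 1))\<^sup>a\<close>, where \<open>c\<^sup>a\<close> is the principal value and the last
  factor is the binomial series. This is a power series precisely if \<open>d a\<close> is a natural
  number. Otherwise \<open>f\<^sup>a\<close> has no expansion in nonnegative integer powers of \<open>x\<close>, and
  the value is set to \<open>0\<close> by convention, in the same spirit as \<open>x / 0 = 0\<close>.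
\<close>
definition fps_cpow :: "complex fps \<Rightarrow> complex \<Rightarrow> complex fps" where
  "fps_cpow f a =
     (let d = subdegree f; u = fps_shift d f; c = fps_nth u 0
      in if of_nat d * a \<in> \<nat>
         then fps_X ^ (THE N. of_nat d * a = of_nat N) * fps_const (c powr a) *
              (fps_binomial a oo (fps_const (inverse c) * u - 1))
         else 0)"

lemma fps_cpow_of_nat:
  assumes "f \<noteq> 0"
  shows "fps_cpow f (of_nat n) = f ^ n"
proof -
  define d where "d = subdegree f"
  define u where "u = fps_shift d f"
  define c where "c = fps_nth u 0"
  have c: "c \<noteq> 0"
    using assms by (simp add: c_def u_def d_def)
  have f: "f = u * fps_X ^ d"
    unfolding u_def d_def by (rule subdegree_decompose)
  have mem: "of_nat d * of_nat n \<in> (\<nat> :: complex set)"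
    by (metis of_nat_in_Nats of_nat_mult)
  have N: "(THE N. of_nat d * of_nat n = (of_nat N :: complex)) = d * n"
    by (rule the_equality) (metis of_nat_mult of_nat_eq_iff)+
  have z: "fps_nth (fps_const (inverse c) * u - 1) 0 = 0"
    using c by (simp add: c_def)
  have "fps_binomial (of_nat n) oo (fps_const (inverse c) * u - 1) =
          (fps_const (inverse c) * u) ^ n"
    unfolding fps_binomial_of_nat
    by (subst fps_compose_power[OF z, symmetric])
       (simp add: fps_compose_add_distrib fps_X_fps_compose_startby0[OF z])
  moreover have "fps_const (c powr of_nat n) = fps_const c ^ n"
    using c by (simp add: powr_nat' fps_const_power)
  moreover have "fps_const c ^ n * (fps_const (inverse c) * u) ^ n = u ^ n"
    using c unfolding power_mult_distrib[symmetric] mult.assoc[symmetric] by simp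
  ultimately have "fps_cpow f (of_nat n) = fps_X ^ (d * n) * u ^ n"
    unfolding fps_cpow_def Let_def
    using mem N by (simp flip: d_def u_def c_def add: mult.assoc)
  also have "\<dots> = f ^ n"
    by (subst f) (simp add: power_mult_distrib power_mult mult.commute)
  finally show ?thesis .
qed

lemma fps_cpow_add:
  assumes "fps_nth f 0 \<noteq> 0"
  shows "fps_cpow f (a + b) = fps_cpow f a * fps_cpow f b"
proof -
  define c where "c = fps_nth f 0"
  have d: "subdegree f = 0"
    using assms by simp
  have N: "(THE N. (0::complex) = of_nat N) = 0"
    by (rule the_equality) auto
  have *: "fps_cpow f a = fps_const (c powr a) *
             (fps_binomial a oo (fps_const (inverse c) * f - 1))" for a
    by (simp add: fps_cpow_def Let_def d c_def N)
  have z: "fps_nth (fps_const (inverse c) * f - 1) 0 = 0"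
    using assms by (simp add: c_def)
  have "fps_const (c powr (a + b)) = fps_const (c powr a) * fps_const (c powr b)"
    by (simp add: powr_add)
  thus ?thesis
    unfolding * fps_binomial_add_mult fps_compose_mult_distrib[OF z]
    by (simp only: mult_ac)
qed

definition fps_polylog :: "int \<Rightarrow> complex fps" where
  "fps_polylog k = Abs_fps (\<lambda>r. if r = 0 then 0 else 1 / of_nat r powi k)"

text \<open>
  The series of \<open>log (1 + x) / Li\<^sub>k (1 - e\<^sup>-\<^sup>x)\<close>. Numerator and denominator both have
  subdegree 1, so the division of power series is exact.
\<close>
definition poly_daehee_quotient :: "int \<Rightarrow> complex fps" where
  "poly_daehee_quotient k = fps_ln 1 / (fps_polylog k oo (1 - fps_exp (-1)))"

lemma poly_daehee_quotient_mult:
  "poly_daehee_quotient k * (fps_polylog k oo (1 - fps_exp (-1))) = fps_ln 1"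
proof -
  let ?L = "fps_polylog k oo (1 - fps_exp (-1))"
  have 0: "fps_nth ?L 0 = 0"
    by (simp add: fps_polylog_def)
  have 1: "fps_nth ?L 1 = 1"
    by (simp add: fps_compose_nth fps_polylog_def)
  have "subdegree ?L = 1"
    by (rule subdegreeI) (use 0 1 in auto)
  moreover have "subdegree (fps_ln 1 :: complex fps) \<ge> 1"
    by (rule subdegree_geI) (auto simp: fps_ln_def fps_eq_iff intro!: exI[of _ 1])
  moreover have "?L \<noteq> 0"
    using 1 by (metis fps_zero_nth zero_neq_one)
  ultimately have "?L dvd fps_ln 1"
    by (subst fps_dvd_iff) (auto simp del: subdegree_fps_compose)
  thus ?thesis
    unfolding poly_daehee_quotient_def by simp
qed

definition apostol_bernoulli_denom :: "nat \<Rightarrow> real \<Rightarrow> complex fps" where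
  "apostol_bernoulli_denom m lam =
     fps_const (complex_of_real lam) * fps_exp 1 - (\<Sum>l<m. fps_const (1 / fact l) * fps_X ^ l)"

text \<open>
  For \<open>m \<ge> 1\<close> the denominator has subdegree \<open>m\<close> if \<open>lam = 1\<close> and \<open>0\<close> otherwise, so this
  division is exact as well. In particular the power \<open>a\<close> of the quotient is a genuine power series
  for every complex \<open>a\<close> if \<open>lam = 1\<close>, and if \<open>lam \<noteq> 1\<close> for those \<open>a\<close> with \<open>m a\<close> natural.
\<close>
definition apostol_bernoulli_quotient :: "nat \<Rightarrow> real \<Rightarrow> complex fps" where
  "apostol_bernoulli_quotient m lam = fps_X ^ m / apostol_bernoulli_denom m lam"

lemma apostol_bernoulli_quotient_mult:
  assumes "m \<ge> 1"
  shows "apostol_bernoulli_quotient m lam * apostol_bernoulli_denom m lam = fps_X ^ m"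
proof -
  let ?D = "apostol_bernoulli_denom m lam"
  have sum: "fps_nth (\<Sum>l<m. fps_const (1 / fact l) * fps_X ^ l :: complex fps) i =
               (if i < m then 1 / fact i else 0)" for i
    by (simp add: fps_sum_nth if_distrib[of "\<lambda>x. _ * x"] cong: if_cong)
  have nth: "fps_nth ?D i = of_real lam / fact i - (if i < m then 1 / fact i else 0)" for i
    unfolding apostol_bernoulli_denom_def fps_sub_nth sum by simp
  have ex: "\<exists>i\<le>m. fps_nth ?D i \<noteq> 0"
  proof (cases "lam = 1")
    case True
    have "fps_nth ?D m \<noteq> 0"
      unfolding nth by (simp add: True)
    thus ?thesis by blast
  next
    case False
    have "fps_nth ?D 0 \<noteq> 0"
      unfolding nth using False assms by simp
    thus ?thesis by blast
  qed
  then obtain i where i: "i \<le> m" "fps_nth ?D i \<noteq> 0"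
    by blast
  have "?D \<noteq> 0" "subdegree ?D \<le> m"
    using i subdegree_leI[OF i(2)] by auto
  hence "?D dvd fps_X ^ m"
    by (simp add: fps_dvd_iff)
  thus ?thesis
    unfolding apostol_bernoulli_quotient_def by simp
qed

definition gen_apostol_bernoulli :: "nat \<Rightarrow> nat \<Rightarrow> complex \<Rightarrow> real \<Rightarrow> real \<Rightarrow> complex" where
  "gen_apostol_bernoulli m n a \<eta> lam =
     fact n * fps_nth (fps_exp (of_real \<eta>) * fps_cpow (apostol_bernoulli_quotient m lam) a) n"

text \<open>
  The paper's notation for these also carries \<open>a\<close> and \<open>m\<close>, on which they do not depend.
\<close>
definition poly_daehee :: "int \<Rightarrow> nat \<Rightarrow> real \<Rightarrow> real \<Rightarrow> complex" where
  "poly_daehee k n \<gamma> \<theta> =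
     fact n * fps_nth (fps_binomial (of_real \<gamma>) * poly_daehee_quotient k *
                       fps_exp (of_real \<theta>)) n"

text \<open>Generalized Apostol-Bernoulli poly-Daehee polynomials.\<close>
definition gabpdp ::
  "int \<Rightarrow> nat \<Rightarrow> nat \<Rightarrow> complex \<Rightarrow> real \<Rightarrow> real \<Rightarrow> real \<Rightarrow> complex" where
  "gabpdp k m n a \<gamma> \<eta> lam =
     fact n * fps_nth (fps_binomial (of_real \<gamma>) * poly_daehee_quotient k *
                       fps_exp (of_real \<eta>) * fps_cpow (apostol_bernoulli_quotient m lam) a) n"

end

theory Submission
  imports Defs
begin

text \<open>Since e^(\<eta> x) = e^((\<eta> - \<omega>) x) e^(\<omega> x), the generating function
  of \<open>gabpdp\<close> at \<eta> is that of \<open>poly_daehee\<close> at \<eta> - \<omega>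
  times that of \<open>gen_apostol_bernoulli\<close> at \<omega>. Multiplying exponential generating
  functions convolves their coefficients binomially (\<open>fact_mult_fps_nth_mult\<close>).\<close>

lemma fact_mult_fps_nth_mult:
  fixes F G :: "'a::field_char_0 fps"
  shows "fact n * fps_nth (F * G) n =
    (\<Sum>j=0..n. of_nat (n choose j) * (fact (n - j) * fps_nth F (n - j)) * (fact j * fps_nth G j))"
proof -
  have "fact n * fps_nth (F * G) n = (\<Sum>j=0..n. fact n * (fps_nth G j * fps_nth F (n - j)))"
    \<comment> \<open>The factors are swapped so that the Cauchy product attaches the index
      \<open>j\<close> to \<open>G\<close> and \<open>n - j\<close> to \<open>F\<close>.\<close>
    by (simp add: mult.commute[of F] fps_mult_nth sum_distrib_left)
  also have "\<dots> = (\<Sum>j=0..n. of_nat (n choose j) * (fact (n - j) * fps_nth F (n - j)) *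
                          (fact j * fps_nth G j))"
    by (rule sum.cong) (simp_all add: binomial_fact)
  finally show ?thesis .
qed

theorem theorem3p3:
  fixes \<gamma> \<eta> \<omega> lam :: real and a :: complex and k :: int and m n :: nat
  assumes "m \<ge> 1"
  shows "gabpdp k m n a \<gamma> \<eta> lam =
    (\<Sum>j=0..n. of_nat (n choose j) * poly_daehee k (n - j) \<gamma> (\<eta> - \<omega>) *
                 gen_apostol_bernoulli m j a \<omega> lam)"
proof -
  have "fps_exp (complex_of_real \<eta>) =
          fps_exp (complex_of_real (\<eta> - \<omega>)) * fps_exp (complex_of_real \<omega>)"
    by (simp flip: fps_exp_add_mult)
  then show ?thesis
    unfolding gabpdp_def poly_daehee_def gen_apostol_bernoulli_def
    \<comment> \<open>Read backwards, the convolution lemma folds the sum into one coefficient of a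
      product; once the exponential is split, both sides differ only in bracketing.\<close>
    by (simp only: fact_mult_fps_nth_mult[symmetric]) (simp only: mult.assoc)
qed

end
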